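(* For every integer $m\geq 2$, there exists a two-dimensional flag complex $X_m$ such that the torsion subgroup of $H_1(X_m)$ is isomorphic to $\mathbb{Z}/m\mathbb{Z}$ and $\operatorname{maxdeg}(X_m)\leq 12$.
   Context: Simplicial complexes are finite. A flag complex is a simplicial complex obtained from a graph by adjoining a $k$-simplex on every $(k+1)$-clique of the graph. The degree of a vertex $v$ of a simplicial complex $X$ is the number of edges (1-simplices) of $X$ containing $v$, and $\operatorname{maxdeg}(X)$ is the maximum degree of a vertex of $X$. $H_1(X)$ denotes the first simplicial homology group with integer coefficients. *)

theory Defs
  imports "HOL-Algebra.Free_Abelian_Groups"
begin

text \<open>Finite abstract simplicial complexes, represented by the set of their (nonempty) simplices.\<close>

definition simplicial_complex :: "'a set set \<Rightarrow> bool" where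
  "simplicial_complex X \<longleftrightarrow>
     finite X \<and> (\<forall>s\<in>X. finite s \<and> s \<noteq> {}) \<and> (\<forall>s\<in>X. \<forall>t. t \<noteq> {} \<longrightarrow> t \<subseteq> s \<longrightarrow> t \<in> X)"

definition simplices :: "nat \<Rightarrow> 'a set set \<Rightarrow> 'a set set" where
  "simplices k X = {s \<in> X. card s = Suc k}"

definition has_dimension :: "'a set set \<Rightarrow> nat \<Rightarrow> bool" where
  "has_dimension X d \<longleftrightarrow> simplices d X \<noteq> {} \<and> (\<forall>s\<in>X. card s \<le> Suc d)"

definition vertex_degree :: "'a set set \<Rightarrow> 'a \<Rightarrow> nat" where
  "vertex_degree X v = card {e \<in> simplices 1 X. v \<in> e}"

definition maxdeg :: "'a set set \<Rightarrow> nat" where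
  "maxdeg X = Max (vertex_degree X ` \<Union>X)"

definition finite_graph :: "'a set \<Rightarrow> 'a set set \<Rightarrow> bool" where
  "finite_graph V E \<longleftrightarrow> finite V \<and> (\<forall>e\<in>E. e \<subseteq> V \<and> card e = 2)"

definition clique :: "'a set \<Rightarrow> 'a set set \<Rightarrow> 'a set \<Rightarrow> bool" where
  "clique V E s \<longleftrightarrow> s \<subseteq> V \<and> (\<forall>u\<in>s. \<forall>v\<in>s. u \<noteq> v \<longrightarrow> {u, v} \<in> E)"

definition flag_complex :: "'a set set \<Rightarrow> bool" where
  "flag_complex X \<longleftrightarrow> (\<exists>V E. finite_graph V E \<and> X = {s. s \<noteq> {} \<and> clique V E s})"

lemma simplicial_complex_if_flag_complex:
  assumes "flag_complex X"
  shows "simplicial_complex X"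
proof -
  obtain V E where "finite V"
    and X: "X = {s. s \<noteq> {} \<and> clique V E s}"
    using assms by (auto simp: flag_complex_def finite_graph_def)
  then have "X \<subseteq> Pow V"
    by (auto simp: clique_def)
  then have "finite X" and "\<forall>s\<in>X. finite s"
    using \<open>finite V\<close> by (auto dest: finite_subset)
  moreover have "\<forall>s\<in>X. \<forall>t. t \<noteq> {} \<longrightarrow> t \<subseteq> s \<longrightarrow> t \<in> X"
    unfolding X clique_def by blast
  ultimately show ?thesis
    using X by (simp add: simplicial_complex_def)
qed

text \<open>
  Simplicial homology with integer coefficients. Every simplex is oriented by the linear order
  of the vertex type, so that the k-th chain group is free abelian on the k-simplices themselves.
  The homology is not augmented: the boundary of a 0-chain is 0.
\<close>

definition simplicial_chain_group :: "nat \<Rightarrow> 'a set set \<Rightarrow> ('a set \<Rightarrow>\<^sub>0 int) monoid" where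
  "simplicial_chain_group k X = free_Abelian_group (simplices k X)"

text \<open>The i-th face of a simplex omits its i-th vertex in increasing order, counting from 0.\<close>

definition simplex_face :: "nat \<Rightarrow> 'a::linorder set \<Rightarrow> 'a set" where
  "simplex_face i s = s - {sorted_list_of_set s ! i}"

definition simplicial_boundary :: "nat \<Rightarrow> ('a::linorder set \<Rightarrow>\<^sub>0 int) \<Rightarrow> ('a set \<Rightarrow>\<^sub>0 int)" where
  "simplicial_boundary k c =
     (if k = 0 then 0
      else frag_extend (\<lambda>s. \<Sum>i\<le>k. frag_cmul ((-1) ^ i) (frag_of (simplex_face i s))) c)"

definition simplicial_cycles :: "nat \<Rightarrow> 'a::linorder set set \<Rightarrow> ('a set \<Rightarrow>\<^sub>0 int) set" where
  "simplicial_cycles k X =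
     {c \<in> carrier (simplicial_chain_group k X). simplicial_boundary k c = 0}"

definition simplicial_boundaries :: "nat \<Rightarrow> 'a::linorder set set \<Rightarrow> ('a set \<Rightarrow>\<^sub>0 int) set" where
  "simplicial_boundaries k X =
     simplicial_boundary (Suc k) ` carrier (simplicial_chain_group (Suc k) X)"

definition simplicial_homology :: "nat \<Rightarrow> 'a::linorder set set \<Rightarrow> ('a set \<Rightarrow>\<^sub>0 int) set monoid" where
  "simplicial_homology k X =
     subgroup_generated (simplicial_chain_group k X) (simplicial_cycles k X)
       Mod simplicial_boundaries k X"

text \<open>In an abelian group the elements of finite order already form a subgroup.\<close>

definition torsion_subgroup :: "('a, 'b) monoid_scheme \<Rightarrow> ('a, 'b) monoid_scheme" where
  "torsion_subgroup G =
     subgroup_generated G {x \<in> carrier G. \<exists>n::nat. n > 0 \<and> x [^]\<^bsub>G\<^esub> n = \<one>\<^bsub>G\<^esub>}"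

end

theory Submission
  imports Defs
begin

text \<open>
  Take a cylinder triangulated so that a single helix \<open>0, 2, 4, \<dots>, 6m\<close> visits all its vertices, the
  circumference being three steps, and let the loop class \<open>\<gamma>\<close> be one turn of the helix. The helix from
  \<open>0\<close> to \<open>6m\<close> and the straight line \<open>0, 6, 12, \<dots>, 6m\<close> have the same ends and together represent \<open>m\<gamma>\<close>.
  Glue in a thin triangulated disc along them; it has bounded degree since it runs along the cylinder
  instead of being coned off. After the removal of one triangle \<open>t0\<close> of the disc, first the rest of the
  disc and then the cylinder collapse to a graph that contains \<open>\<gamma>\<close>. Hence the first homology is that of
  a graph modulo the boundary of \<open>t0\<close>, which is homologous to \<open>m\<gamma>\<close> with \<open>\<gamma>\<close> primitive, and its torsion
  subgroup is cyclic of order \<open>m\<close>.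
\<close>

section \<open>Torsion of the first homology from a collapse\<close>

text \<open>In \<open>G Mod B\<close>, the hypothesis \<open>torsion\<close> makes every element of
  finite order a power of the coset of \<open>x\<close>, and \<open>order\<close> gives that coset
  order exactly \<open>m\<close>. Raising it to the power \<open>k\<close> is then the isomorphism
  from the residues.\<close>

lemma (in comm_group) torsion_subgroup_FactGroup_cyclic:
  assumes B: "subgroup B G" and x: "x \<in> carrier G" and "m > 0"
    and torsion: "\<And>z n. \<lbrakk>z \<in> carrier G; (n::nat) > 0; z [^] n \<in> B\<rbrakk> \<Longrightarrow> \<exists>k::int. z \<otimes> inv (x [^] k) \<in> B"
    and order: "\<And>k::int. x [^] k \<in> B \<longleftrightarrow> int m dvd k"
  shows "torsion_subgroup (G Mod B) \<cong> integer_mod_group m"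
proof -
  define H where "H = G Mod B"
  define y where "y = B #> x"
  have "B \<lhd> G"
    using B by (simp add: normal_iff_subgroup)
  then interpret B: normal B G .
  interpret H: comm_group H
    unfolding H_def using B by (rule abelian_FactGroup)
  have y: "y \<in> carrier H"
    using x by (auto simp: y_def H_def carrier_FactGroup)
  have y_pow: "y [^]\<^bsub>H\<^esub> k = B #> (x [^] k)" for k :: int
    unfolding y_def H_def using x by (rule B.FactGroup_int_pow)
  have one_iff: "B #> z = \<one>\<^bsub>H\<^esub> \<longleftrightarrow> z \<in> B" if "z \<in> carrier G" for z
    using coset_join1[OF _ that B] coset_join2[OF that B] unfolding H_def one_FactGroup by blast
  have y_one: "y [^]\<^bsub>H\<^esub> k = \<one>\<^bsub>H\<^esub> \<longleftrightarrow> int m dvd k" for k :: int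
    using one_iff[of "x [^] k"] order x by (simp add: y_pow)
  have y_eq: "y [^]\<^bsub>H\<^esub> k = y [^]\<^bsub>H\<^esub> l \<longleftrightarrow> int m dvd k - l" for k l :: int
    unfolding y_one[symmetric] using y
    by (metis H.int_pow_closed H.int_pow_diff H.inv_closed H.inv_equality H.inv_inv H.r_inv)
  have torsion_set: "{u \<in> carrier H. \<exists>n::nat. n > 0 \<and> u [^]\<^bsub>H\<^esub> n = \<one>\<^bsub>H\<^esub>} = range (\<lambda>k::int. y [^]\<^bsub>H\<^esub> k)"
  proof (intro equalityI subsetI)
    fix u assume "u \<in> {u \<in> carrier H. \<exists>n::nat. n > 0 \<and> u [^]\<^bsub>H\<^esub> n = \<one>\<^bsub>H\<^esub>}"
    then obtain z n where z: "z \<in> carrier G" "u = B #> z" and n: "n > 0" "u [^]\<^bsub>H\<^esub> (n::nat) = \<one>\<^bsub>H\<^esub>"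
      by (auto simp: H_def carrier_FactGroup)
    have "B #> (z [^] n) = \<one>\<^bsub>H\<^esub>"
      using n z B.FactGroup_pow[of z n] by (simp add: H_def)
    then have "z [^] n \<in> B"
      using one_iff z(1) by simp
    then obtain k :: int where "z \<otimes> inv (x [^] k) \<in> B"
      using torsion z(1) n(1) by blast
    then have "z \<in> B #> (x [^] k)"
      using x z(1) by (simp add: B.rcos_module_rev is_group)
    then have "u = y [^]\<^bsub>H\<^esub> k"
      using B x y_pow z(2) repr_independence by simp
    then show "u \<in> range (\<lambda>k::int. y [^]\<^bsub>H\<^esub> k)"
      by blast
  next
    fix u assume "u \<in> range (\<lambda>k::int. y [^]\<^bsub>H\<^esub> k)"
    then obtain k :: int where "u = y [^]\<^bsub>H\<^esub> k"
      by blast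
    then have "u [^]\<^bsub>H\<^esub> int m = \<one>\<^bsub>H\<^esub>" "u \<in> carrier H"
      using y y_one[of "k * int m"] by (simp_all add: H.int_pow_pow)
    then have "u [^]\<^bsub>H\<^esub> m = \<one>\<^bsub>H\<^esub>" "u \<in> carrier H"
      by (simp_all add: int_pow_int)
    then show "u \<in> {u \<in> carrier H. \<exists>n::nat. n > 0 \<and> u [^]\<^bsub>H\<^esub> n = \<one>\<^bsub>H\<^esub>}"
      using \<open>m > 0\<close> by auto
  qed
  have T: "carrier (torsion_subgroup H) = range (\<lambda>k::int. y [^]\<^bsub>H\<^esub> k)"
    unfolding torsion_subgroup_def torsion_set
    using H.subgroup_of_powers[OF y] by (rule subgroup.carrier_subgroup_generated_subgroup)
  have "(\<lambda>k. y [^]\<^bsub>H\<^esub> k) \<in> iso (integer_mod_group m) (torsion_subgroup H)"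
    unfolding iso_iff
  proof (intro conjI)
    show "(\<lambda>k. y [^]\<^bsub>H\<^esub> k) \<in> hom (integer_mod_group m) (torsion_subgroup H)"
    proof (rule homI)
      fix k l
      \<comment> \<open>The operation of \<open>integer_mod_group m\<close> reduces the sum modulo
        \<open>m\<close>, which does not affect the power of \<open>y\<close>.\<close>
      have "int m dvd (k + l) mod int m - (k + l)"
        by (simp add: mod_eq_dvd_iff[symmetric])
      then show "y [^]\<^bsub>H\<^esub> (k \<otimes>\<^bsub>integer_mod_group m\<^esub> l) = y [^]\<^bsub>H\<^esub> k \<otimes>\<^bsub>torsion_subgroup H\<^esub> y [^]\<^bsub>H\<^esub> l"
        using y by (simp add: torsion_subgroup_def y_eq flip: H.int_pow_mult)
    qed (simp add: T)
    show "(\<lambda>k. y [^]\<^bsub>H\<^esub> k) ` carrier (integer_mod_group m) = carrier (torsion_subgroup H)"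
    proof
      show "carrier (torsion_subgroup H) \<subseteq> (\<lambda>k. y [^]\<^bsub>H\<^esub> k) ` carrier (integer_mod_group m)"
      proof
        fix u assume "u \<in> carrier (torsion_subgroup H)"
        then obtain k :: int where "u = y [^]\<^bsub>H\<^esub> k"
          by (auto simp: T)
        moreover have "int m dvd k - k mod int m"
          by (simp add: mod_eq_dvd_iff[symmetric])
        ultimately have "u = y [^]\<^bsub>H\<^esub> (k mod int m)"
          by (simp add: y_eq)
        moreover have "k mod int m \<in> carrier (integer_mod_group m)"
          using \<open>m > 0\<close> by (simp add: carrier_integer_mod_group)
        ultimately show "u \<in> (\<lambda>k. y [^]\<^bsub>H\<^esub> k) ` carrier (integer_mod_group m)"
          by blast
      qed
    qed (auto simp: T)
    show "inj_on (\<lambda>k. y [^]\<^bsub>H\<^esub> k) (carrier (integer_mod_group m))"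
    proof (rule inj_onI)
      fix k l
      assume "k \<in> carrier (integer_mod_group m)" "l \<in> carrier (integer_mod_group m)"
        "y [^]\<^bsub>H\<^esub> k = y [^]\<^bsub>H\<^esub> l"
      then show "k = l"
        using \<open>m > 0\<close> by (simp add: carrier_integer_mod_group y_eq flip: mod_eq_dvd_iff)
    qed
  qed
  then have "integer_mod_group m \<cong> torsion_subgroup H"
    by (rule is_isoI)
  then show ?thesis
    using group.iso_sym[OF group_integer_mod_group] H_def by blast
qed

section \<open>Divisibility of chains through pivots\<close>

lemma lookup_frag_extend:
  "Poly_Mapping.lookup (frag_extend d c) e =
     (\<Sum>t\<in>Poly_Mapping.keys c. Poly_Mapping.lookup c t * Poly_Mapping.lookup (d t) e)"
  by (simp add: frag_extend_def lookup_sum)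

text \<open>A triangular system with unit diagonal: the coefficient at \<open>p t\<close> is a unit
  times that of \<open>t\<close> plus contributions of smaller rank, so divisibility climbs the
  ranks by induction. For \<open>n = 0\<close> this is linear independence.\<close>

lemma dvd_lookup_if_pivots:
  fixes n :: int and r :: "'a \<Rightarrow> nat"
  assumes c: "Poly_Mapping.keys c \<subseteq> T"
    and unit: "\<And>t. t \<in> T \<Longrightarrow> \<bar>Poly_Mapping.lookup (d t) (p t)\<bar> = 1"
    and rank: "\<And>t t'. \<lbrakk>t \<in> T; t' \<in> T; t' \<noteq> t; Poly_Mapping.lookup (d t') (p t) \<noteq> 0\<rbrakk> \<Longrightarrow> r t' < r t"
    and dvd: "\<And>t. t \<in> T \<Longrightarrow> n dvd Poly_Mapping.lookup (frag_extend d c) (p t)"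
  shows "n dvd Poly_Mapping.lookup c t"
proof (induction "r t" arbitrary: t rule: less_induct)
  case less
  show ?case
  proof (cases "t \<in> Poly_Mapping.keys c")
    case True
    let ?s = "\<lambda>t'. Poly_Mapping.lookup c t' * Poly_Mapping.lookup (d t') (p t)"
    have t: "t \<in> T"
      using True c by blast
    have "n dvd ?s t'" if "t' \<in> Poly_Mapping.keys c - {t}" for t'
    proof (cases "Poly_Mapping.lookup (d t') (p t) = 0")
      case False
      then have "r t' < r t"
        using that c t rank by blast
      then show ?thesis
        using less by simp
    qed simp
    then have "n dvd sum ?s (Poly_Mapping.keys c - {t})"
      by (intro dvd_sum) blast
    moreover have "Poly_Mapping.lookup (frag_extend d c) (p t) = ?s t + sum ?s (Poly_Mapping.keys c - {t})"
      unfolding lookup_frag_extend using True by (simp add: sum.remove)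
    ultimately have "n dvd ?s t"
      using dvd[OF t] by (simp add: dvd_add_left_iff)
    moreover have "Poly_Mapping.lookup (d t) (p t) dvd 1"
      using unit[OF t] by simp
    ultimately show ?thesis
      by (metis dvd_mult_unit_iff)
  qed (simp add: in_keys_iff)
qed

lemma frag_divide:
  assumes "\<And>t. n dvd Poly_Mapping.lookup c t"
  obtains q where "c = frag_cmul n q" "Poly_Mapping.keys q \<subseteq> Poly_Mapping.keys c"
proof
  define q where "q = Abs_poly_mapping (\<lambda>t. Poly_Mapping.lookup c t div n)"
  have "finite {t. Poly_Mapping.lookup c t div n \<noteq> 0}"
    by (rule finite_subset[of _ "Poly_Mapping.keys c"]) (auto simp: in_keys_iff)
  then have lookup_q: "Poly_Mapping.lookup q t = Poly_Mapping.lookup c t div n" for t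
    by (simp add: q_def)
  show "c = frag_cmul n q"
    using assms by (intro poly_mapping_eqI) (simp add: lookup_q)
  show "Poly_Mapping.keys q \<subseteq> Poly_Mapping.keys c"
    by (auto simp: in_keys_iff lookup_q)
qed

lemma frag_cmul_diff: "frag_cmul n (x - y) = frag_cmul n x - frag_cmul n y"
  by (intro poly_mapping_eqI) (simp add: lookup_minus right_diff_distrib)

section \<open>Boundaries and cycles in low degrees\<close>

lemma simplicial_boundary_diff:
  "simplicial_boundary k (x - y) = simplicial_boundary k x - simplicial_boundary k y"
  by (simp add: simplicial_boundary_def frag_extend_diff)

lemma simplicial_boundary_add:
  "simplicial_boundary k (x + y) = simplicial_boundary k x + simplicial_boundary k y"
  by (simp add: simplicial_boundary_def frag_extend_add)

lemma simplicial_boundary_cmul: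
  "simplicial_boundary k (frag_cmul n x) = frag_cmul n (simplicial_boundary k x)"
  by (simp add: simplicial_boundary_def frag_extend_cmul)

lemma simplicial_boundary_0 [simp]: "simplicial_boundary k 0 = 0"
  by (simp add: simplicial_boundary_def)

lemma simplicial_boundary_eq_frag_extend:
  "simplicial_boundary k c = frag_extend (\<lambda>s. simplicial_boundary k (frag_of s)) c"
  by (auto simp: simplicial_boundary_def frag_extend_eq_0 intro!: frag_extend_eq)

lemma sorted_list_of_set_2: "a < b \<Longrightarrow> sorted_list_of_set {a, b} = [a, b]"
  for a b :: "'a::linorder"
  by (simp add: less_imp_le)

lemma sorted_list_of_set_3:
  fixes a b c :: "'a::linorder"
  assumes "a < b" "b < c"
  shows "sorted_list_of_set {a, b, c} = [a, b, c]"
proof -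
  have "a < c"
    using assms by (rule less_trans)
  then have "sorted_list_of_set (set [a, b, c]) = [a, b, c]"
    using assms by (intro sorted_list_of_set.idem_if_sorted_distinct) auto
  then show ?thesis
    by (simp only: list.set)
qed

lemma simplicial_boundary_edge:
  fixes a b :: "'a::linorder"
  assumes "a < b"
  shows "simplicial_boundary 1 (frag_of {a, b}) = frag_of {b} - frag_of {a}"
proof -
  have "{a, b} - {a} = {b}" "{a, b} - {b} = {a}"
    using assms by auto
  then show ?thesis
    using assms by (simp add: simplicial_boundary_def simplex_face_def sorted_list_of_set_2 less_imp_le)
qed

lemma simplicial_boundary_triangle:
  fixes a b c :: "'a::linorder"
  assumes "a < b" "b < c"
  shows "simplicial_boundary 2 (frag_of {a, b, c}) = frag_of {b, c} - frag_of {a, c} + frag_of {a, b}"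
proof -
  have "{a, b, c} - {a} = {b, c}" "{a, b, c} - {b} = {a, c}" "{a, b, c} - {c} = {a, b}"
    using assms by auto
  then show ?thesis
    using assms
    by (simp add: simplicial_boundary_def simplex_face_def sorted_list_of_set_3 numeral_2_eq_2
        del: sorted_list_of_set_insert_remove)
qed

lemma card_3_linorderE:
  fixes s :: "'a::linorder set"
  assumes "card s = 3"
  obtains a b c where "s = {a, b, c}" "a < b" "b < c"
proof -
  have fin: "finite s"
    using assms card.infinite by fastforce
  obtain xs where xs: "xs = sorted_list_of_set s" "length xs = 3"
    using assms by simp
  from xs(2) obtain a b c where "xs = [a, b, c]"
    by (auto simp: length_Suc_conv numeral_3_eq_3)
  then have "sorted_list_of_set s = [a, b, c]"
    using xs(1) by simp
  moreover have "sorted_wrt (<) (sorted_list_of_set s)"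
    by simp
  moreover have "s = set (sorted_list_of_set s)"
    using fin by simp
  ultimately show thesis
    using that[of a b c] by auto
qed

lemma simplicial_boundary_boundary_triangle:
  assumes "card s = 3"
  shows "simplicial_boundary 1 (simplicial_boundary 2 (frag_of s)) = 0"
  using assms
  by (elim card_3_linorderE)
    (simp add: simplicial_boundary_triangle simplicial_boundary_edge
      simplicial_boundary_add simplicial_boundary_diff del: One_nat_def)

lemma keys_diff_subset:
  "Poly_Mapping.keys x \<subseteq> S \<Longrightarrow> Poly_Mapping.keys y \<subseteq> S \<Longrightarrow> Poly_Mapping.keys (x - y) \<subseteq> S"
  using keys_diff[of x y] by blast

lemma keys_add_subset:
  "Poly_Mapping.keys x \<subseteq> S \<Longrightarrow> Poly_Mapping.keys y \<subseteq> S \<Longrightarrow> Poly_Mapping.keys (x + y) \<subseteq> S"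
  using keys_add[of x y] by blast

lemma keys_cmul_subset: "Poly_Mapping.keys x \<subseteq> S \<Longrightarrow> Poly_Mapping.keys (frag_cmul n x) \<subseteq> S"
  using keys_cmul[of n x] by blast

lemmas keys_subset_intros = keys_diff_subset keys_add_subset keys_cmul_subset

lemma mem_simplicial_cycles:
  "c \<in> simplicial_cycles k X \<longleftrightarrow> Poly_Mapping.keys c \<subseteq> simplices k X \<and> simplicial_boundary k c = 0"
  by (simp add: simplicial_cycles_def simplicial_chain_group_def)

lemma simplicial_boundary_triangle_in_cycles:
  assumes X: "simplicial_complex X" and s: "s \<in> simplices 2 X"
  shows "simplicial_boundary 2 (frag_of s) \<in> simplicial_cycles 1 X"
proof -
  have card: "card s = 3" and sX: "s \<in> X"
    using s by (auto simp: simplices_def)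
  from card obtain a b c where abc: "s = {a, b, c}" "a < b" "b < c"
    by (rule card_3_linorderE)
  have "t \<in> X" if "t \<noteq> {}" "t \<subseteq> s" for t
    using X sX that unfolding simplicial_complex_def by meson
  then have "{b, c} \<in> X" "{a, c} \<in> X" "{a, b} \<in> X"
    by (simp_all add: abc(1))
  then have "{b, c} \<in> simplices 1 X" "{a, c} \<in> simplices 1 X" "{a, b} \<in> simplices 1 X"
    using abc by (auto simp: simplices_def)
  then have "Poly_Mapping.keys (simplicial_boundary 2 (frag_of s)) \<subseteq> simplices 1 X"
    unfolding abc(1) simplicial_boundary_triangle[OF abc(2,3)]
    by (intro keys_subset_intros) auto
  then show ?thesis
    using simplicial_boundary_boundary_triangle[OF card]
    by (simp add: mem_simplicial_cycles)
qed

lemma simplicial_boundary_in_cycles: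
  assumes X: "simplicial_complex X" and c: "Poly_Mapping.keys c \<subseteq> simplices 2 X"
  shows "simplicial_boundary 2 c \<in> simplicial_cycles 1 X"
  using c
proof (induction c rule: frag_induction)
  case (one s)
  then show ?case
    by (rule simplicial_boundary_triangle_in_cycles[OF X])
qed (simp_all add: mem_simplicial_cycles simplicial_boundary_diff keys_diff_subset)

text \<open>
  If the triangles other than \<open>t0\<close> can be removed one after the other through free edges \<open>p t\<close>,
  then up to homotopy \<open>X\<close> is a graph with the single 2-cell \<open>t0\<close> attached, and the torsion of its
  first homology is governed by the divisibility of the boundary of \<open>t0\<close>.
\<close>

lemma torsion_simplicial_homology_1:
  fixes X :: "'a::linorder set set" and r :: "'a set \<Rightarrow> nat"
  assumes X: "simplicial_complex X" and "m > 0"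
    and t0: "t0 \<in> simplices 2 X" and g: "g \<in> simplicial_cycles 1 X"
    and c: "Poly_Mapping.keys c \<subseteq> simplices 2 X - {t0}"
    and rel: "simplicial_boundary 2 (frag_of t0 + c) = frag_cmul (int m) g"
    and unit: "\<And>t. t \<in> simplices 2 X - {t0} \<Longrightarrow>
      \<bar>Poly_Mapping.lookup (simplicial_boundary 2 (frag_of t)) (p t)\<bar> = 1"
    and rank: "\<And>t t'. \<lbrakk>t \<in> simplices 2 X - {t0}; t' \<in> simplices 2 X - {t0}; t' \<noteq> t;
      Poly_Mapping.lookup (simplicial_boundary 2 (frag_of t')) (p t) \<noteq> 0\<rbrakk> \<Longrightarrow> r t' < r t"
    and g_p: "\<And>t. t \<in> simplices 2 X - {t0} \<Longrightarrow> Poly_Mapping.lookup g (p t) = 0"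
    and g_e: "\<bar>Poly_Mapping.lookup g e\<bar> = 1"
  shows "torsion_subgroup (simplicial_homology 1 X) \<cong> integer_mod_group m"
proof -
  define C where "C = simplicial_chain_group 1 X"
  define Z where "Z = simplicial_cycles 1 X"
  define B where "B = simplicial_boundaries 1 X"
  let ?T = "simplices 2 X - {t0}" and ?d = "simplicial_boundary 2" and ?G = "subgroup_generated C Z"
  have B: "B = ?d ` {c. Poly_Mapping.keys c \<subseteq> simplices 2 X}"
    unfolding B_def simplicial_boundaries_def Suc_1
    by (rule arg_cong[where f = "(`) _"]) (auto simp: simplicial_chain_group_def)
  have "comm_group C"
    by (simp add: C_def simplicial_chain_group_def abelian_free_Abelian_group)
  then interpret C: comm_group C .
  have C_simps: "carrier C = {x. Poly_Mapping.keys x \<subseteq> simplices 1 X}" "\<one>\<^bsub>C\<^esub> = 0"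
    "x \<otimes>\<^bsub>C\<^esub> y = x + y" "x [^]\<^bsub>C\<^esub> n = frag_cmul (int n) x" for x y and n :: nat
    by (auto simp: C_def simplicial_chain_group_def)
  have C_inv: "inv\<^bsub>C\<^esub> x = - x" if "x \<in> carrier C" for x
    using that by (simp add: C_def simplicial_chain_group_def)
  have C_int_pow: "x [^]\<^bsub>C\<^esub> n = frag_cmul n x" if "x \<in> carrier C" for x and n :: int
    using that by (simp add: C_def simplicial_chain_group_def)
  have Z_C: "Z \<subseteq> carrier C"
    by (auto simp: Z_def C_def simplicial_cycles_def)
  have Z_diff: "x - y \<in> Z" if "x \<in> Z" "y \<in> Z" for x y
    using that by (simp add: Z_def mem_simplicial_cycles simplicial_boundary_diff keys_diff_subset)
  have Z_0: "0 \<in> Z"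
    by (simp add: Z_def mem_simplicial_cycles)
  have Z_subgroup: "subgroup Z C"
  proof (rule C.subgroupI)
    fix x y assume xy: "x \<in> Z" "y \<in> Z"
    have "x - (0 - y) \<in> Z"
      using xy by (intro Z_diff Z_0)
    then show "x \<otimes>\<^bsub>C\<^esub> y \<in> Z"
      by (simp add: C_simps)
  next
    fix x assume "x \<in> Z"
    then show "inv\<^bsub>C\<^esub> x \<in> Z"
      using Z_diff[OF Z_0, of x] C_inv[of x] Z_C by auto
  qed (use Z_C Z_0 in auto)
  have G_carrier: "carrier ?G = Z"
    using Z_subgroup by (rule subgroup.carrier_subgroup_generated_subgroup)
  have B_Z: "B \<subseteq> Z"
    using simplicial_boundary_in_cycles[OF X] by (auto simp: B Z_def)
  have B_diff: "x - y \<in> B" if "x \<in> B" "y \<in> B" for x y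
  proof -
    obtain c d where "x = ?d c" "Poly_Mapping.keys c \<subseteq> simplices 2 X"
      "y = ?d d" "Poly_Mapping.keys d \<subseteq> simplices 2 X"
      using \<open>x \<in> B\<close> \<open>y \<in> B\<close> by (auto simp: B)
    then show ?thesis
      unfolding B by (intro image_eqI[of _ _ "c - d"])
        (simp_all add: simplicial_boundary_diff keys_diff_subset)
  qed
  have B_0: "0 \<in> B"
    unfolding B by (intro image_eqI[of _ _ 0]) auto
  have "subgroup B C"
  proof (rule C.subgroupI)
    fix x y assume xy: "x \<in> B" "y \<in> B"
    have "x - (0 - y) \<in> B"
      using xy by (intro B_diff B_0)
    then show "x \<otimes>\<^bsub>C\<^esub> y \<in> B"
      by (simp add: C_simps)
  next
    fix x assume "x \<in> B"
    then show "inv\<^bsub>C\<^esub> x \<in> B"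
      using B_diff[OF B_0, of x] C_inv[of x] Z_C B_Z by auto
  qed (use Z_C B_Z B_0 in auto)
  then have B_subgroup: "subgroup B ?G"
    using B_Z by (simp add: C.subgroup_subgroup_generated_iff G_carrier)
  interpret G: comm_group ?G
    using \<open>comm_group C\<close> by (rule C.abelian_subgroup_generated)
  have G_pow: "x [^]\<^bsub>?G\<^esub> n = frag_cmul (int n) x" for x and n :: nat
    by (simp add: pow_subgroup_generated C_simps)
  have G_int_pow: "x [^]\<^bsub>?G\<^esub> n = frag_cmul n x" if "x \<in> Z" for x and n :: int
    using that C_int_pow Z_C by (simp add: C.int_pow_subgroup_generated G_carrier subset_iff)
  \<comment> \<open>At the pivots \<open>g\<close> vanishes, so the boundary of \<open>d\<close> is
    divisible by \<open>n\<close> there, and hence so is \<open>d\<close>. Comparing coefficients at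
    \<open>e\<close> then gives \<open>n dvd k\<close>. Positive \<open>n\<close> will serve for
    torsion, \<open>n = 0\<close> for the order of \<open>g\<close>.\<close>
  have divisible: "(\<exists>y. d = frag_cmul n y \<and> Poly_Mapping.keys y \<subseteq> ?T) \<and> n dvd k"
    if d: "Poly_Mapping.keys d \<subseteq> ?T" and z: "frag_cmul k g + ?d d = frag_cmul n z"
    for d n k z
  proof -
    have dvd: "n dvd Poly_Mapping.lookup d t" for t
    proof (rule dvd_lookup_if_pivots[where d = "\<lambda>t. ?d (frag_of t)" and T = ?T and p = p and r = r, OF d unit rank])
      fix t assume "t \<in> ?T"
      have "Poly_Mapping.lookup (?d d) (p t) = Poly_Mapping.lookup (frag_cmul k g + ?d d) (p t)"
        using g_p[OF \<open>t \<in> ?T\<close>] by (simp add: lookup_add)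
      also have "\<dots> = n * Poly_Mapping.lookup z (p t)"
        unfolding z by simp
      finally show "n dvd Poly_Mapping.lookup (frag_extend (\<lambda>t. ?d (frag_of t)) d) (p t)"
        unfolding simplicial_boundary_eq_frag_extend[of 2 d] by simp
    qed
    then obtain y where y: "d = frag_cmul n y" "Poly_Mapping.keys y \<subseteq> Poly_Mapping.keys d"
      by (rule frag_divide)
    have "k * Poly_Mapping.lookup g e = Poly_Mapping.lookup (frag_cmul n z - ?d d) e"
      unfolding z[symmetric] by simp
    also have "?d d = frag_cmul n (?d y)"
      unfolding y(1) by (rule simplicial_boundary_cmul)
    also have "Poly_Mapping.lookup (frag_cmul n z - frag_cmul n (?d y)) e
      = n * (Poly_Mapping.lookup z e - Poly_Mapping.lookup (?d y) e)"
      by (simp add: lookup_minus right_diff_distrib)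
    finally have "n dvd k * Poly_Mapping.lookup g e"
      by (rule dvdI)
    moreover have "Poly_Mapping.lookup g e dvd 1"
      using g_e by simp
    ultimately have "n dvd k"
      by (simp add: dvd_mult_unit_iff)
    moreover have "Poly_Mapping.keys y \<subseteq> ?T"
      using y(2) d by (rule subset_trans)
    ultimately show ?thesis
      using y(1) by blast
  qed
  \<comment> \<open>By \<open>rel\<close> the chain \<open>t0 + c\<close> bounds \<open>m\<close>
    times \<open>g\<close>; subtracting the right multiple of it removes \<open>t0\<close> from
    \<open>d\<close>, because \<open>c\<close> avoids \<open>t0\<close>.\<close>
  have boundary_split: "\<exists>d'. Poly_Mapping.keys d' \<subseteq> ?T \<and>
      ?d d = frag_cmul (Poly_Mapping.lookup d t0 * int m) g + ?d d'"
    if "Poly_Mapping.keys d \<subseteq> simplices 2 X" for d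
  proof (intro exI conjI)
    let ?d' = "d - frag_cmul (Poly_Mapping.lookup d t0) (frag_of t0 + c)"
    have "Poly_Mapping.keys ?d' \<subseteq> simplices 2 X"
      using that c t0 by (intro keys_subset_intros) auto
    moreover have "Poly_Mapping.lookup c t0 = 0"
      using c in_keys_iff[of t0 c] by blast
    then have "Poly_Mapping.lookup ?d' t0 = 0"
      by (simp add: lookup_minus lookup_add)
    then have "t0 \<notin> Poly_Mapping.keys ?d'"
      by (simp only: in_keys_iff)
    ultimately show "Poly_Mapping.keys ?d' \<subseteq> ?T"
      by blast
    show "?d d = frag_cmul (Poly_Mapping.lookup d t0 * int m) g + ?d ?d'"
      unfolding simplicial_boundary_diff simplicial_boundary_cmul rel by simp
  qed
  have g_B: "frag_cmul k g \<in> B \<longleftrightarrow> int m dvd k" for k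
  proof
    assume "frag_cmul k g \<in> B"
    then obtain d where d: "Poly_Mapping.keys d \<subseteq> simplices 2 X" "frag_cmul k g = ?d d"
      unfolding B by (elim imageE CollectE)
    obtain d' where d': "Poly_Mapping.keys d' \<subseteq> ?T"
      "?d d = frag_cmul (Poly_Mapping.lookup d t0 * int m) g + ?d d'"
      using boundary_split[OF d(1)] by (elim exE conjE)
    let ?k = "Poly_Mapping.lookup d t0 * int m - k"
    have "frag_cmul ?k g + ?d d' = (frag_cmul (Poly_Mapping.lookup d t0 * int m) g + ?d d') - frag_cmul k g"
      unfolding frag_cmul_diff_distrib by simp
    also have "\<dots> = frag_cmul 0 0"
      unfolding d(2) d'(2) by (simp only: diff_self frag_cmul_zero)
    \<comment> \<open>The case \<open>n = 0\<close>: a multiple of \<open>g\<close> that bounds away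
      from \<open>t0\<close> is zero.\<close>
    finally have "0 dvd ?k"
      using divisible[OF d'(1), of ?k 0 0] by blast
    then have "k = Poly_Mapping.lookup d t0 * int m"
      by simp
    then show "int m dvd k"
      by simp
  next
    assume "int m dvd k"
    then obtain j where j: "k = int m * j" ..
    have "frag_cmul k g = ?d (frag_cmul j (frag_of t0 + c))"
      unfolding simplicial_boundary_cmul rel frag_cmul_cmul j by (simp only: mult.commute)
    moreover have "Poly_Mapping.keys (frag_cmul j (frag_of t0 + c)) \<subseteq> simplices 2 X"
      using c t0 by (intro keys_subset_intros) auto
    ultimately show "frag_cmul k g \<in> B"
      unfolding B by blast
  qed
  have torsion: "\<exists>k. z - frag_cmul k g \<in> B" if n: "(n::nat) > 0" and "frag_cmul (int n) z \<in> B" for z n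
  proof -
    from \<open>frag_cmul (int n) z \<in> B\<close> obtain d
      where d: "Poly_Mapping.keys d \<subseteq> simplices 2 X" "frag_cmul (int n) z = ?d d"
      unfolding B by (elim imageE CollectE)
    obtain d' k where d': "Poly_Mapping.keys d' \<subseteq> ?T"
      "frag_cmul k g + ?d d' = frag_cmul (int n) z"
      using boundary_split[OF d(1)] unfolding d(2) by metis
    obtain y j where y: "d' = frag_cmul (int n) y" "Poly_Mapping.keys y \<subseteq> ?T" "k = int n * j"
      using divisible[OF d'] by (elim conjE exE dvdE)
    \<comment> \<open>Both \<open>d'\<close> and \<open>k\<close> are multiples of \<open>n\<close>,
      and chains have no torsion, so \<open>n\<close> cancels.\<close>
    have "frag_cmul (int n) (z - frag_cmul j g - ?d y) = 0"
      unfolding frag_cmul_diff d'(2)[symmetric] unfolding y by (simp add: simplicial_boundary_cmul)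
    then have "z - frag_cmul j g = ?d y"
      using n by simp
    then show ?thesis
      using y(2) unfolding B by blast
  qed
  have gZ: "g \<in> Z"
    using g by (simp only: Z_def)
  have "torsion_subgroup (?G Mod B) \<cong> integer_mod_group m"
  proof (rule G.torsion_subgroup_FactGroup_cyclic[OF B_subgroup _ \<open>m > 0\<close>])
    show "g \<in> carrier ?G"
      using gZ by (simp add: G_carrier)
  next
    fix z and n :: nat
    assume "z \<in> carrier ?G" "n > 0" "z [^]\<^bsub>?G\<^esub> n \<in> B"
    then obtain k where k: "z - frag_cmul k g \<in> B"
      using torsion by (auto simp: G_pow)
    have "g [^]\<^bsub>?G\<^esub> k \<in> carrier ?G"
      using gZ G.int_pow_closed G_carrier by blast
    then have "inv\<^bsub>?G\<^esub> (g [^]\<^bsub>?G\<^esub> k) = - frag_cmul k g"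
      using C.inv_subgroup_generated C_inv G_carrier G_int_pow gZ Z_C by (metis subsetD)
    then show "\<exists>k::int. z \<otimes>\<^bsub>?G\<^esub> inv\<^bsub>?G\<^esub> (g [^]\<^bsub>?G\<^esub> k) \<in> B"
      using k by (intro exI[of _ k]) (simp add: C_simps del: minus_frag_cmul)
  qed (simp add: G_int_pow gZ g_B)
  then show ?thesis
    by (simp only: simplicial_homology_def C_def Z_def B_def)
qed

section \<open>The complex\<close>

text \<open>
  The vertex \<open>2n\<close> is the \<open>n\<close>-th vertex of the helix; in the cylinder it is joined to those that are
  1, 3 and 4 steps ahead. The odd vertices are the inner vertices of the disc: \<open>2n + 1\<close> is joined to both
  ends of the \<open>n\<close>-th helix step and to a vertex \<open>6j\<close> of the straight line that lies so far behind that
  no unwanted triangles appear. The last two cases of the definition fill the two ends of the disc.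
\<close>

definition spiral_adj :: "nat \<Rightarrow> nat \<Rightarrow> nat \<Rightarrow> bool" where
  "spiral_adj m v w \<longleftrightarrow> v < w \<and> w \<le> 6 * m \<and>
     (w = v + 1 \<or> w = v + 2 \<or>
      even v \<and> (w = v + 6 \<or> w = v + 8) \<or>
      6 dvd v \<and> (w = v + 11 \<or> w = v + 13 \<or> w = v + 15 \<or> w = v + 17) \<or>
      v = 1 \<and> (w = 5 \<or> w = 7 \<or> w = 9 \<or> w = 11) \<or>
      v + 6 = 6 * m \<and> w + 1 = 6 * m)"

text \<open>In the order of the disjuncts: the strip between the helix and the odd vertices, the
  cylinder, the fans from the vertices \<open>6j\<close>, the triangles on the straight line, the
  fan from 1 with the triangle attaching it to 0, and two triangles at the far end. The very last
  one is set aside for the collapse.\<close>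

definition spiral_triangle :: "nat \<Rightarrow> nat \<Rightarrow> nat \<Rightarrow> nat \<Rightarrow> bool" where
  "spiral_triangle m a b c \<longleftrightarrow> c \<le> 6 * m \<and>
     (b = a + 1 \<and> c = a + 2 \<or>
      even a \<and> (b = a + 2 \<or> b = a + 6) \<and> c = a + 8 \<or>
      6 dvd a \<and> (b = a + 11 \<or> b = a + 13 \<or> b = a + 15) \<and> c = b + 2 \<or>
      6 dvd a \<and> b = a + 6 \<and> c = a + 17 \<or>
      a = 1 \<and> (b = 3 \<or> b = 5 \<or> b = 7 \<or> b = 9) \<and> c = b + 2 \<or>
      a = 0 \<and> b = 1 \<and> c = 11 \<or>
      a + 12 = 6 * m \<and> b + 6 = 6 * m \<and> c + 1 = 6 * m \<or>
      a + 6 = 6 * m \<and> b + 1 = 6 * m \<and> c = 6 * m)"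

lemma spiral_adj_if_triangle:
  assumes "m \<ge> 2" "spiral_triangle m a b c"
  shows "spiral_adj m a b" "spiral_adj m b c" "spiral_adj m a c"
proof -
  \<comment> \<open>With \<open>m = k + 2\<close> the conditions at the far end name the vertices:
    \<open>a + 12 = 6 * m\<close> becomes \<open>a = 6 * k\<close>.\<close>
  from assms(1) obtain k where k: "m = k + 2"
    by (metis le_Suc_ex add.commute)
  have "spiral_adj m a b \<and> spiral_adj m b c \<and> spiral_adj m a c"
    using assms(2) unfolding spiral_triangle_def spiral_adj_def k
    by (elim disjE conjE dvdE; simp)
  then show "spiral_adj m a b" "spiral_adj m b c" "spiral_adj m a c"
    by simp_all
qed

lemma spiral_adjE:
  assumes "spiral_adj (k + 2) v w"
  obtains "w = v + 1" | "w = v + 2" | l where "v = 2 * l" "w = 2 * l + 6" | l where "v = 2 * l" "w = 2 * l + 8"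
    | j where "v = 6 * j" "w = 6 * j + 11" | j where "v = 6 * j" "w = 6 * j + 13"
    | j where "v = 6 * j" "w = 6 * j + 15" | j where "v = 6 * j" "w = 6 * j + 17"
    | "v = 1" "w = 5" | "v = 1" "w = 7" | "v = 1" "w = 9" | "v = 1" "w = 11"
    | "v = 6 * k + 6" "w = 6 * k + 11"
  using assms unfolding spiral_adj_def by (elim conjE disjE dvdE) simp_all

lemma spiral_adj_le: "spiral_adj m v w \<Longrightarrow> w \<le> 6 * m"
  by (simp add: spiral_adj_def)

text \<open>Passing to the flag complex fills no unintended 3-clique. Each of the 13 kinds of edge
  from \<open>a\<close> to \<open>b\<close> is paired with each kind from \<open>b\<close> to
  \<open>c\<close>; the third edge then leaves linear arithmetic with divisibility by 2 and
  6.\<close>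

lemma spiral_triangle_if_adj:
  assumes "m \<ge> 2" "spiral_adj m a b" "spiral_adj m b c" and ac: "spiral_adj m a c"
  shows "spiral_triangle m a b c"
proof -
  from assms(1) obtain k where k: "m = k + 2"
    by (metis le_Suc_ex add.commute)
  show ?thesis
    using assms(2,3) ac spiral_adj_le[OF ac] unfolding k
    by (elim spiral_adjE[of k a b] spiral_adjE[of k b c])
      (simp_all add: spiral_adj_def spiral_triangle_def, presburger+)
qed

text \<open>
  The collapse: the triangle \<open>a < b < c\<close> is removed through its edge \<open>spiral_pivot a b c\<close>, in order of
  increasing rank. The disc comes first, from its far end backwards, and then the cylinder from its
  near end. The triangle \<open>{0, 1, 11}\<close> needs an exceptional rank because for \<open>m = 2\<close> it is adjacent to
  \<open>{0, 6, 11}\<close> rather than to \<open>{0, 11, 13}\<close>.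
\<close>

definition spiral_pivot :: "nat \<Rightarrow> nat \<Rightarrow> nat \<Rightarrow> nat \<times> nat" where
  "spiral_pivot a b c =
     (if even a \<and> c = a + 8 then if b = a + 2 then (a, c) else (a, b)
      else if c = a + 2 \<or> even a \<and> b = a + 6 then (b, c) else (a, c))"

text \<open>As \<open>a\<close> and \<open>c\<close> are at most \<open>6 * m\<close>, the
  subtraction of \<open>3 * a + 12 * c\<close> is never truncated. Disc ranks stay below
  \<open>90 * m\<close> because \<open>b < c\<close>, so the cylinder ranks exceed them all. The
  value \<open>90 * m - 118\<close> is one less than the rank of \<open>{1, 9, 11}\<close>, whose
  pivot \<open>{1, 11}\<close> lies in \<open>{0, 1, 11}\<close>.\<close>

definition spiral_rank :: "nat \<Rightarrow> nat \<Rightarrow> nat \<Rightarrow> nat \<Rightarrow> nat" where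
  "spiral_rank m a b c =
     (if even a \<and> c = a + 8 then 102 * m + a + (if b = a + 2 then 2 else 1)
      else if b = 1 \<and> c = 11 then 90 * m - 118
      else 90 * m + 2 * b - (3 * a + 12 * c))"

text \<open>Pivot and rank in closed form for each kind of triangle. The disc ranks appear as sums
  instead of differences so that linear arithmetic can compare them.\<close>

lemma spiral_triangleE:
  assumes "spiral_triangle (k + 2) a b c" "(a, b, c) \<noteq> (6 * k + 6, 6 * k + 11, 6 * k + 12)"
    and p: "spiral_pivot a b c = p" and r: "spiral_rank (k + 2) a b c = r"
  obtains "b = a + 1" "c = a + 2" "p = (a + 1, a + 2)"
      "r + 13 * a = 90 * k + 158"
    | l where "a = 2 * l" "b = 2 * l + 2" "c = 2 * l + 8" "p = (2 * l, 2 * l + 8)"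
      "r = 102 * k + 206 + 2 * l"
    | l where "a = 2 * l" "b = 2 * l + 6" "c = 2 * l + 8" "p = (2 * l, 2 * l + 6)"
      "r = 102 * k + 205 + 2 * l"
    | j where "a = 6 * j" "b = 6 * j + 11" "c = 6 * j + 13" "p = (6 * j, 6 * j + 13)"
      "r + 78 * j = 90 * k + 46"
    | j where "a = 6 * j" "b = 6 * j + 13" "c = 6 * j + 15" "p = (6 * j, 6 * j + 15)"
      "r + 78 * j = 90 * k + 26"
    | j where "a = 6 * j" "b = 6 * j + 15" "c = 6 * j + 17" "p = (6 * j, 6 * j + 17)"
      "r + 78 * j = 90 * k + 6"
    | j where "a = 6 * j" "b = 6 * j + 6" "c = 6 * j + 17" "p = (6 * j + 6, 6 * j + 17)"
      "r + 78 * j + 12 = 90 * k"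
    | "a = 1" "b = 3" "c = 5" "p = (1, 5)" "r = 90 * k + 123"
    | "a = 1" "b = 5" "c = 7" "p = (1, 7)" "r = 90 * k + 103"
    | "a = 1" "b = 7" "c = 9" "p = (1, 9)" "r = 90 * k + 83"
    | "a = 1" "b = 9" "c = 11" "p = (1, 11)" "r = 90 * k + 63"
    | "a = 0" "b = 1" "c = 11" "p = (0, 11)" "r = 90 * k + 62"
    | "a = 6 * k" "b = 6 * k + 6" "c = 6 * k + 11" "p = (6 * k + 6, 6 * k + 11)"
      "r = 12 * k + 60"
proof -
  show thesis
    using assms(1) unfolding spiral_triangle_def
    apply (elim conjE disjE dvdE)
    apply (rule that(1); force simp: spiral_pivot_def spiral_rank_def simp flip: p r)
    apply (rule that(2), assumption, (simp add: spiral_pivot_def spiral_rank_def flip: p r)+)[1]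
    apply (rule that(3), assumption, (simp add: spiral_pivot_def spiral_rank_def flip: p r)+)[1]
    apply (rule that(4), assumption, (simp add: spiral_pivot_def spiral_rank_def flip: p r)+)[1]
    apply (rule that(5), assumption, (simp add: spiral_pivot_def spiral_rank_def flip: p r)+)[1]
    apply (rule that(6), assumption, (simp add: spiral_pivot_def spiral_rank_def flip: p r)+)[1]
    apply (rule that(7), assumption, (simp add: spiral_pivot_def spiral_rank_def flip: p r)+)[1]
    apply (rule that(8); simp add: spiral_pivot_def spiral_rank_def flip: p r)
    apply (rule that(9); simp add: spiral_pivot_def spiral_rank_def flip: p r)
    apply (rule that(10); simp add: spiral_pivot_def spiral_rank_def flip: p r)
    apply (rule that(11); simp add: spiral_pivot_def spiral_rank_def flip: p r)
    apply (rule that(12); simp add: spiral_pivot_def spiral_rank_def flip: p r)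
    apply (rule that(13); simp add: spiral_pivot_def spiral_rank_def flip: p r)
    using assms(2) by simp
qed

text \<open>This verifies the collapse: once the triangles of smaller rank are gone, the pivot is a
  free edge. All pairs of kinds are compared, for each of the three positions of the pivot in the
  other triangle.\<close>

lemma spiral_rank_less:
  assumes t: "spiral_triangle (k + 2) a b c" "(a, b, c) \<noteq> (6 * k + 6, 6 * k + 11, 6 * k + 12)"
    and t': "spiral_triangle (k + 2) a' b' c'" "(a', b', c') \<noteq> (6 * k + 6, 6 * k + 11, 6 * k + 12)"
    and ne: "(a', b', c') \<noteq> (a, b, c)"
    and p: "spiral_pivot a b c = (u, w)" "u = a' \<and> w = b' \<or> u = a' \<and> w = c' \<or> u = b' \<and> w = c'"
    and le: "c \<le> 6 * k + 12" "c' \<le> 6 * k + 12"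
  shows "spiral_rank (k + 2) a' b' c' < spiral_rank (k + 2) a b c"
proof -
  obtain r r' p' where r: "spiral_rank (k + 2) a b c = r"
    and r': "spiral_rank (k + 2) a' b' c' = r'" "spiral_pivot a' b' c' = p'"
    by blast
  have ne': "a = a' \<Longrightarrow> b = b' \<Longrightarrow> c = c' \<Longrightarrow> False"
    using ne by simp
  have "r' < r" if "u = a'" "w = b'"
    by (rule spiral_triangleE[OF t' r'(2,1)]; rule spiral_triangleE[OF t p(1) r];
        insert that ne' le; simp; presburger?)
  moreover have "r' < r" if "u = a'" "w = c'"
    by (rule spiral_triangleE[OF t' r'(2,1)]; rule spiral_triangleE[OF t p(1) r];
        insert that ne' le; simp; presburger?)
  moreover have "r' < r" if "u = b'" "w = c'"
    by (rule spiral_triangleE[OF t' r'(2,1)]; rule spiral_triangleE[OF t p(1) r];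
        insert that ne' le; simp; presburger?)
  ultimately show ?thesis
    using p(2) unfolding r r' by blast
qed

section \<open>The flag complex, its dimension and its degrees\<close>

definition spiral_edges :: "nat \<Rightarrow> nat set set" where
  "spiral_edges m = {{v, w} |v w. spiral_adj m v w}"

definition spiral_complex :: "nat \<Rightarrow> nat set set" where
  "spiral_complex m = {s. s \<noteq> {} \<and> clique {..6 * m} (spiral_edges m) s}"

lemma spiral_adj_less: "spiral_adj m v w \<Longrightarrow> v < w"
  by (simp add: spiral_adj_def)

lemma spiral_triangle_less:
  assumes "m \<ge> 2" "spiral_triangle m a b c"
  shows "a < b" "b < c" "c \<le> 6 * m"
  using spiral_adj_if_triangle[OF assms] spiral_adj_less spiral_adj_le by blast+

lemma flag_complex_spiral_complex: "flag_complex (spiral_complex m)"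
proof -
  have "finite_graph {..6 * m} (spiral_edges m)"
    unfolding finite_graph_def
  proof (intro conjI ballI)
    fix e assume "e \<in> spiral_edges m"
    then obtain v w where "e = {v, w}" "v < w" "w \<le> 6 * m"
      unfolding spiral_edges_def using spiral_adj_less spiral_adj_le by blast
    then show "e \<subseteq> {..6 * m}" "card e = 2"
      by simp_all
  qed simp
  then show ?thesis
    unfolding flag_complex_def spiral_complex_def by blast
qed

lemma spiral_edge_iff:
  assumes "v < w"
  shows "{v, w} \<in> spiral_edges m \<longleftrightarrow> spiral_adj m v w"
proof
  assume "{v, w} \<in> spiral_edges m"
  then obtain v' w' where "{v, w} = {v', w'}" "spiral_adj m v' w'"
    unfolding spiral_edges_def by blast
  with assms show "spiral_adj m v w"
    by (metis doubleton_eq_iff order.asym spiral_adj_less)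
qed (auto simp: spiral_edges_def)

lemma spiral_complex_adj:
  assumes "s \<in> spiral_complex m" "v \<in> s" "w \<in> s" "v < w"
  shows "spiral_adj m v w"
proof -
  have "{v, w} \<in> spiral_edges m"
    using assms by (simp add: spiral_complex_def clique_def)
  then show ?thesis
    using assms(4) by (simp add: spiral_edge_iff)
qed

lemma spiral_complexI:
  assumes "s \<noteq> {}" "s \<subseteq> {..6 * m}" "\<And>v w. \<lbrakk>v \<in> s; w \<in> s; v < w\<rbrakk> \<Longrightarrow> spiral_adj m v w"
  shows "s \<in> spiral_complex m"
proof -
  have "{v, w} \<in> spiral_edges m" if "v \<in> s" "w \<in> s" "v \<noteq> w" for v w
    using assms(3)[of v w] assms(3)[of w v] that spiral_edge_iff[of v w m] spiral_edge_iff[of w v m]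
    by (metis insert_commute linorder_neqE_nat)
  then show ?thesis
    using assms(1,2) by (simp add: spiral_complex_def clique_def)
qed

lemma simplices_1_spiral_complex: "simplices 1 (spiral_complex m) = spiral_edges m"
proof (intro equalityI subsetI)
  fix s assume s: "s \<in> simplices 1 (spiral_complex m)"
  then have "card s = 2"
    by (simp add: simplices_def)
  then obtain v w where vw: "s = {v, w}" "v \<noteq> w"
    by (auto simp: card_2_iff)
  then show "s \<in> spiral_edges m"
    using s by (simp add: simplices_def spiral_complex_def clique_def)
next
  fix s assume "s \<in> spiral_edges m"
  then obtain v w where s: "s = {v, w}" "spiral_adj m v w"
    unfolding spiral_edges_def by blast
  then have "v < w" "w \<le> 6 * m"
    using spiral_adj_less spiral_adj_le by blast+
  then show "s \<in> simplices 1 (spiral_complex m)"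
    using s by (auto simp: simplices_def intro!: spiral_complexI)
qed

lemma simplices_2_spiral_complex:
  assumes m: "m \<ge> 2"
  shows "simplices 2 (spiral_complex m) = {{a, b, c} |a b c. spiral_triangle m a b c}"
proof (intro equalityI subsetI)
  fix s assume s: "s \<in> simplices 2 (spiral_complex m)"
  then have "card s = 3"
    by (simp add: simplices_def)
  then obtain a b c where abc: "s = {a, b, c}" "a < b" "b < c"
    by (rule card_3_linorderE)
  have sX: "s \<in> spiral_complex m"
    using s by (simp add: simplices_def)
  have "spiral_triangle m a b c"
    using abc by (intro spiral_triangle_if_adj[OF m] spiral_complex_adj[OF sX]) auto
  then show "s \<in> {{a, b, c} |a b c. spiral_triangle m a b c}"
    using abc(1) by blast
next
  fix s assume "s \<in> {{a, b, c} |a b c. spiral_triangle m a b c}"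
  then obtain a b c where s: "s = {a, b, c}" and abc: "spiral_triangle m a b c"
    by blast
  note less = spiral_triangle_less[OF m abc]
  have "s \<in> spiral_complex m"
    unfolding s using less spiral_adj_if_triangle[OF m abc] by (intro spiral_complexI) auto
  moreover have "card s = 3"
    using less unfolding s by simp
  ultimately show "s \<in> simplices 2 (spiral_complex m)"
    by (simp add: simplices_def)
qed

text \<open>Both \<open>a, b, c\<close> and \<open>b, c, d\<close> would be listed triangles, and no
  two of these that overlap in this way have \<open>a\<close> adjacent to \<open>d\<close>.\<close>

lemma spiral_no_4_clique:
  assumes m: "m \<ge> 2" and adj: "spiral_adj m a b" "spiral_adj m a c" "spiral_adj m b c"
    "spiral_adj m a d" "spiral_adj m b d" "spiral_adj m c d"
  shows False
proof -
  from m obtain k where k: "m = k + 2"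
    by (metis le_Suc_ex add.commute)
  have abc: "spiral_triangle m a b c" and bcd: "spiral_triangle m b c d"
    using m adj by (blast intro: spiral_triangle_if_adj)+
  have d: "d \<le> 6 * k + 12" "c < d"
    using spiral_adj_le[OF adj(6)] spiral_adj_less[OF adj(6)] k by simp_all
  \<comment> \<open>The excluded triangle ends in the largest vertex, but \<open>c < d\<close>. Only
    \<open>b, c, d\<close> can be that triangle, hence the case distinction below.\<close>
  have abc': "(a, b, c) \<noteq> (6 * k + 6, 6 * k + 11, 6 * k + 12)"
    using d by simp
  obtain p r where pr: "spiral_pivot a b c = p" "spiral_rank (k + 2) a b c = r"
    by blast
  obtain p' r' where pr': "spiral_pivot b c d = p'" "spiral_rank (k + 2) b c d = r'"
    by blast
  show False
  proof (cases "(b, c, d) = (6 * k + 6, 6 * k + 11, 6 * k + 12)")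
    case True
    show ?thesis
      by (rule spiral_triangleE[OF abc[unfolded k] abc' pr];
          insert True adj(4); simp add: spiral_adj_def k; elim conjE; linarith)
  next
    case False
    show ?thesis
      by (rule spiral_triangleE[OF abc[unfolded k] abc' pr];
          rule spiral_triangleE[OF bcd[unfolded k] False pr'];
          insert adj(4) d; simp add: spiral_adj_def k; (auto; fail | presburger))
  qed
qed

lemma card_spiral_complex:
  assumes m: "m \<ge> 2" and s: "s \<in> spiral_complex m"
  shows "card s \<le> 3"
proof (rule ccontr)
  assume "\<not> card s \<le> 3"
  then obtain t where t: "t \<subseteq> s" "card t = 4" "finite t"
    using obtain_subset_with_card_n[of 4 s] by auto
  obtain xs where xs: "xs = sorted_list_of_set t" "length xs = 4"
    using t by simp
  from xs(2) obtain a b c d where "xs = [a, b, c, d]"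
    by (auto simp: length_Suc_conv numeral_eq_Suc)
  moreover have "sorted_wrt (<) xs" "set xs \<subseteq> s"
    using t by (simp_all add: xs(1))
  ultimately have "a < b" "b < c" "c < d" "a \<in> s" "b \<in> s" "c \<in> s" "d \<in> s"
    by auto
  then show False
    by (intro spiral_no_4_clique[OF m, of a b c d] spiral_complex_adj[OF s]) auto
qed

lemma has_dimension_spiral_complex:
  assumes m: "m \<ge> 2"
  shows "has_dimension (spiral_complex m) 2"
proof -
  have "spiral_triangle m 0 1 2"
    using m by (simp add: spiral_triangle_def)
  then have "simplices 2 (spiral_complex m) \<noteq> {}"
    unfolding simplices_2_spiral_complex[OF m] by blast
  then show ?thesis
    using card_spiral_complex[OF m] by (simp add: has_dimension_def)
qed

text \<open>The full twelve entries are needed only at the vertices \<open>6j\<close>: six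
  neighbours in the cylinder, the two adjacent odd vertices, and the four odd vertices of a fan.
  Truncated subtraction near 0 merely adds spurious entries.\<close>

lemma spiral_neighbours:
  assumes m: "m \<ge> 2"
  obtains L where "length L \<le> 12" "{w. spiral_adj m v w \<or> spiral_adj m w v} \<subseteq> set L"
proof -
  let ?N = "{w. spiral_adj m v w \<or> spiral_adj m w v}"
  let ?L = "[v + 1, v + 2, v + 6, v + 8, v - 1, v - 2, v - 6, v - 8]"
  consider "v = 1" | "odd v" "v \<noteq> 1" | "even v" "\<not> 6 dvd v" | "6 dvd v" "v + 6 \<noteq> 6 * m" | "v + 6 = 6 * m"
    by auto
  then show thesis
  proof cases
    case 1
    have "w \<in> set [0, 2, 3, 5, 7, 9, 11]" if "spiral_adj m v w \<or> spiral_adj m w v" for w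
      using that 1 unfolding spiral_adj_def by (elim disjE conjE; simp; presburger?)
    then have "?N \<subseteq> set [0, 2, 3, 5, 7, 9, 11]"
      by blast
    then show ?thesis
      by (rule that[rotated]) simp
  next
    case 2
    define u where "u = 6 * m - 6"
    have u: "6 * m = u + 6"
      using m by (simp add: u_def)
    have odd: "\<not> 6 dvd v" "v + 6 \<noteq> 6 * m"
      using 2 by presburger+
    \<comment> \<open>A generous list: the four distant entries cover the possible fan centres
      \<open>6j\<close>, while 1 and \<open>u\<close> account for the two ends of the disc.\<close>
    have "w \<in> set [v + 1, v + 2, v - 1, v - 2, v - 11, v - 13, v - 15, v - 17, 1, u]"
      if "spiral_adj m v w \<or> spiral_adj m w v" for w
      using that 2 odd unfolding spiral_adj_def u by (elim disjE conjE; simp)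
    then have "?N \<subseteq> set [v + 1, v + 2, v - 1, v - 2, v - 11, v - 13, v - 15, v - 17, 1, u]"
      by blast
    then show ?thesis
      by (rule that[rotated]) simp
  next
    case 3
    then have not6: "v + 6 \<noteq> 6 * m" "Suc v \<noteq> 6 * m"
      by presburger+
    have "w \<in> set ?L" if "spiral_adj m v w \<or> spiral_adj m w v" for w
      using that 3 not6 unfolding spiral_adj_def by (elim disjE conjE; simp; presburger?)
    then have "?N \<subseteq> set ?L"
      by blast
    then show ?thesis
      by (rule that[rotated]) simp
  next
    case 4
    then have not6: "Suc v \<noteq> 6 * m" "even v"
      by presburger+
    have "w \<in> set (?L @ [v + 11, v + 13, v + 15, v + 17])" if "spiral_adj m v w \<or> spiral_adj m w v" for w
      using that 4 not6 unfolding spiral_adj_def by (elim disjE conjE; simp; presburger?)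
    then have "?N \<subseteq> set (?L @ [v + 11, v + 13, v + 15, v + 17])"
      by blast
    then show ?thesis
      by (rule that[rotated]) simp
  next
    case 5
    then have not6: "Suc v \<noteq> 6 * m" "even v" "6 dvd v"
      by presburger+
    have "w \<in> set (?L @ [v + 5])" if "spiral_adj m v w \<or> spiral_adj m w v" for w
      using that 5 not6 unfolding spiral_adj_def by (elim disjE conjE; simp; presburger?)
    then have "?N \<subseteq> set (?L @ [v + 5])"
      by blast
    then show ?thesis
      by (rule that[rotated]) simp
  qed
qed

lemma vertex_degree_spiral_complex:
  assumes m: "m \<ge> 2"
  shows "vertex_degree (spiral_complex m) v \<le> 12"
proof -
  obtain L where L: "length L \<le> 12" "{w. spiral_adj m v w \<or> spiral_adj m w v} \<subseteq> set L"
    using m by (rule spiral_neighbours)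
  have "{e \<in> spiral_edges m. v \<in> e} \<subseteq> (\<lambda>w. {v, w}) ` set L"
    using L(2) by (auto simp: spiral_edges_def insert_commute)
  then have "card {e \<in> spiral_edges m. v \<in> e} \<le> card ((\<lambda>w. {v, w}) ` set L)"
    by (intro card_mono) auto
  also have "\<dots> \<le> length L"
    using card_image_le card_length order_trans by blast
  finally show ?thesis
    using L(1) unfolding vertex_degree_def simplices_1_spiral_complex by simp
qed

lemma maxdeg_spiral_complex:
  assumes m: "m \<ge> 2"
  shows "maxdeg (spiral_complex m) \<le> 12"
proof -
  have "\<Union> (spiral_complex m) \<subseteq> {..6 * m}"
    by (auto simp: spiral_complex_def clique_def)
  then have "finite (\<Union> (spiral_complex m))"
    using finite_subset by blast
  \<comment> \<open>A vertex is exhibited because \<open>Max\<close> has to be taken over a nonempty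
    set.\<close>
  moreover have "{0} \<in> spiral_complex m"
    by (intro spiral_complexI) auto
  ultimately show ?thesis
    unfolding maxdeg_def using vertex_degree_spiral_complex[OF m]
    by (subst Max_le_iff) auto
qed

section \<open>The relation between the loop and the last triangle\<close>

text \<open>The arguments are meant to be increasing: the set forgets their order, and the edge is
  always oriented towards its larger end.\<close>

definition chain_edge :: "nat \<Rightarrow> nat \<Rightarrow> nat set \<Rightarrow>\<^sub>0 int" where
  "chain_edge v w = frag_of {v, w}"

definition triangle_boundary :: "nat \<Rightarrow> nat \<Rightarrow> nat \<Rightarrow> nat set \<Rightarrow>\<^sub>0 int" where
  "triangle_boundary a b c = chain_edge b c - chain_edge a c + chain_edge a b"

definition last_triangle :: "nat \<Rightarrow> nat set" where
  "last_triangle k = {6 * k + 6, 6 * k + 11, 6 * k + 12}"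

text \<open>Congruence modulo this subgroup is homology after the removal of the last triangle; the
  memberships of differences below are such congruences.\<close>

definition spiral_relations :: "nat \<Rightarrow> (nat set \<Rightarrow>\<^sub>0 int) set" where
  "spiral_relations k = simplicial_boundary 2 `
     {c. Poly_Mapping.keys c \<subseteq> simplices 2 (spiral_complex (k + 2)) - {last_triangle k}}"

lemma spiral_relations_0: "0 \<in> spiral_relations k"
  unfolding spiral_relations_def by (rule image_eqI[of _ _ 0]) auto

lemma spiral_relations_diff:
  assumes "x \<in> spiral_relations k" "y \<in> spiral_relations k"
  shows "x - y \<in> spiral_relations k"
proof -
  obtain c d where
    "x = simplicial_boundary 2 c" "Poly_Mapping.keys c \<subseteq> simplices 2 (spiral_complex (k + 2)) - {last_triangle k}"
    "y = simplicial_boundary 2 d" "Poly_Mapping.keys d \<subseteq> simplices 2 (spiral_complex (k + 2)) - {last_triangle k}"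
    using assms unfolding spiral_relations_def by (elim imageE CollectE)
  then show ?thesis
    unfolding spiral_relations_def
    by (intro image_eqI[of _ _ "c - d"]) (simp_all add: simplicial_boundary_diff keys_diff_subset)
qed

lemma spiral_relations_uminus: "x \<in> spiral_relations k \<Longrightarrow> - x \<in> spiral_relations k"
  using spiral_relations_diff[OF spiral_relations_0, of x] by simp

lemma spiral_relations_add:
  assumes "x \<in> spiral_relations k" "y \<in> spiral_relations k"
  shows "x + y \<in> spiral_relations k"
  using spiral_relations_diff[OF assms(1) spiral_relations_uminus[OF assms(2)]] by simp

lemmas spiral_relations_intros = spiral_relations_diff spiral_relations_add spiral_relations_0

lemma spiral_relations_sum:
  "(\<And>j. j \<in> J \<Longrightarrow> f j \<in> spiral_relations k) \<Longrightarrow> sum f J \<in> spiral_relations k"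
  by (induction J rule: infinite_finite_induct) (auto intro: spiral_relations_intros)

lemma tripleton_eq_if_less:
  fixes a b c :: "'a::linorder"
  assumes "a < b" "b < c" "d < e" "e < f"
  shows "{a, b, c} = {d, e, f} \<longleftrightarrow> a = d \<and> b = e \<and> c = f"
  using sorted_list_of_set_3[OF assms(1,2)] sorted_list_of_set_3[OF assms(3,4)]
  by (metis list.inject)

lemma spiral_relations_triangle:
  assumes t: "spiral_triangle (k + 2) a b c" and ne: "(a, b, c) \<noteq> (6 * k + 6, 6 * k + 11, 6 * k + 12)"
  shows "triangle_boundary a b c \<in> spiral_relations k"
proof -
  have less: "a < b" "b < c"
    using spiral_triangle_less[OF _ t] by simp_all
  have "{a, b, c} \<in> simplices 2 (spiral_complex (k + 2))"
    using t simplices_2_spiral_complex[of "k + 2"] by auto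
  moreover have "{a, b, c} \<noteq> last_triangle k"
    using ne less unfolding last_triangle_def by (subst tripleton_eq_if_less) auto
  ultimately show ?thesis
    unfolding spiral_relations_def using less
    by (intro image_eqI[of _ _ "frag_of {a, b, c}"])
      (simp_all add: simplicial_boundary_triangle triangle_boundary_def chain_edge_def)
qed

text \<open>This zigzag alternates between the helix and the inner vertices of the disc, so it can
  be compared with both.\<close>

definition spiral_path :: "nat \<Rightarrow> nat set \<Rightarrow>\<^sub>0 int" where
  "spiral_path n = (\<Sum>j<n. chain_edge j (Suc j))"

text \<open>A representative of \<gamma>: one turn of the helix, closed by a straight edge.\<close>

definition spiral_loop :: "nat \<Rightarrow> nat set \<Rightarrow>\<^sub>0 int" where
  "spiral_loop v = chain_edge v (v + 2) + chain_edge (v + 2) (v + 4) + chain_edge (v + 4) (v + 6)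
     - chain_edge v (v + 6)"

lemma spiral_path_2:
  "b = a + 1 \<Longrightarrow> c = a + 2 \<Longrightarrow> spiral_path c = spiral_path a + chain_edge a b + chain_edge b c"
  by (simp add: spiral_path_def)

lemma spiral_path_1: "b = a + 1 \<Longrightarrow> spiral_path b = spiral_path a + chain_edge a b"
  by (simp add: spiral_path_def)

text \<open>One strip triangle. For even \<open>v\<close> it replaces two zigzag edges by a helix
  step, for odd \<open>v\<close> by a step between inner vertices.\<close>

lemma spiral_path_skip:
  assumes "v + 2 \<le> 6 * k + 12" "b = v + 1" "c = v + 2"
  shows "spiral_path c - spiral_path v - chain_edge v c \<in> spiral_relations k"
proof -
  have "triangle_boundary v b c \<in> spiral_relations k"
    using assms by (intro spiral_relations_triangle) (auto simp: spiral_triangle_def)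
  moreover have "spiral_path c - spiral_path v - chain_edge v c = triangle_boundary v b c"
    using spiral_path_2[OF assms(2,3)] by (simp add: triangle_boundary_def)
  ultimately show ?thesis
    by simp
qed

text \<open>The two loops differ by the two cylinder triangles that share the edge from
  \<open>v\<close> to \<open>v + 8\<close>.\<close>

lemma spiral_loop_shift:
  assumes "even v" "v + 8 \<le> 6 * k + 12"
  shows "spiral_loop v - spiral_loop (v + 2) \<in> spiral_relations k"
proof -
  have "triangle_boundary v (v + 2) (v + 8) \<in> spiral_relations k"
    "triangle_boundary v (v + 6) (v + 8) \<in> spiral_relations k"
    using assms by (auto intro!: spiral_relations_triangle simp: spiral_triangle_def)
  then have "triangle_boundary v (v + 2) (v + 8) - triangle_boundary v (v + 6) (v + 8) \<in> spiral_relations k"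
    by (rule spiral_relations_diff)
  moreover have "spiral_loop v - spiral_loop (v + 2)
      = triangle_boundary v (v + 2) (v + 8) - triangle_boundary v (v + 6) (v + 8)"
  proof -
    have eqs: "v + 2 + 2 = v + 4" "v + 2 + 4 = v + 6" "v + 2 + 6 = v + 8"
      by simp_all
    show ?thesis
      unfolding spiral_loop_def triangle_boundary_def eqs by (simp only: algebra_simps)
  qed
  ultimately show ?thesis
    by simp
qed

lemma spiral_loop_shifts:
  "v + 2 * n + 6 \<le> 6 * k + 12 \<Longrightarrow> even v \<Longrightarrow> spiral_loop v - spiral_loop (v + 2 * n) \<in> spiral_relations k"
proof (induction n)
  case (Suc n)
  have eq: "v + 2 * Suc n = v + 2 * n + 2"
    by simp
  have IH: "spiral_loop v - spiral_loop (v + 2 * n) \<in> spiral_relations k"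
    using Suc by simp
  have "spiral_loop (v + 2 * n) - spiral_loop (v + 2 * n + 2) \<in> spiral_relations k"
    using Suc.prems by (intro spiral_loop_shift) auto
  from spiral_relations_add[OF IH this] show ?case
    unfolding eq by simp
qed (simp add: spiral_relations_0)

text \<open>The near end of the disc: from 1 on, the zigzag is pushed to the odd vertices, and the
  fan from 1 contracts it.\<close>

lemma spiral_path_start:
  "spiral_path 11 - chain_edge 0 11 \<in> spiral_relations k"
proof -
  have skips: "spiral_path 3 - spiral_path 1 - chain_edge 1 3 \<in> spiral_relations k"
    "spiral_path 5 - spiral_path 3 - chain_edge 3 5 \<in> spiral_relations k"
    "spiral_path 7 - spiral_path 5 - chain_edge 5 7 \<in> spiral_relations k"
    "spiral_path 9 - spiral_path 7 - chain_edge 7 9 \<in> spiral_relations k"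
    "spiral_path 11 - spiral_path 9 - chain_edge 9 11 \<in> spiral_relations k"
    by (auto intro!: spiral_path_skip)
  have fan: "triangle_boundary 1 3 5 \<in> spiral_relations k" "triangle_boundary 1 5 7 \<in> spiral_relations k"
    "triangle_boundary 1 7 9 \<in> spiral_relations k" "triangle_boundary 1 9 11 \<in> spiral_relations k"
    "triangle_boundary 0 1 11 \<in> spiral_relations k"
    by (auto intro!: spiral_relations_triangle simp: spiral_triangle_def)
  have p1: "spiral_path 1 = chain_edge 0 1"
    by (simp add: spiral_path_def)
  have "(spiral_path 3 - spiral_path 1 - chain_edge 1 3)
      + (spiral_path 5 - spiral_path 3 - chain_edge 3 5)
      + (spiral_path 7 - spiral_path 5 - chain_edge 5 7)
      + (spiral_path 9 - spiral_path 7 - chain_edge 7 9)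
      + (spiral_path 11 - spiral_path 9 - chain_edge 9 11)
      + triangle_boundary 1 3 5 + triangle_boundary 1 5 7 + triangle_boundary 1 7 9
      + triangle_boundary 1 9 11 + triangle_boundary 0 1 11 \<in> spiral_relations k" (is "?x \<in> _")
    using skips fan by (intro spiral_relations_add)
  also have "?x = spiral_path 11 - chain_edge 0 11"
    unfolding p1 triangle_boundary_def by (simp only: algebra_simps)
  finally show ?thesis .
qed

text \<open>Sweeping across the disc, the zigzag becomes the straight line up to
  \<open>6 * i\<close> followed by one edge into the disc. Each induction step uses the fan from
  \<open>6 * i\<close> and the triangle on the next straight edge.\<close>

lemma spiral_path_strip:
  "i \<le> k \<Longrightarrow> spiral_path (6 * i + 11) - (\<Sum>j<i. chain_edge (6 * j) (6 * j + 6)) - chain_edge (6 * i) (6 * i + 11)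
     \<in> spiral_relations k"
proof (induction i)
  case 0
  then show ?case
    using spiral_path_start by simp
next
  case (Suc i)
  define x where "x = 6 * i"
  have x: "6 dvd x" "6 * i = x" "x + 6 \<le> 6 * k"
    using Suc.prems by (simp_all add: x_def)
  have eqs: "6 * Suc i = x + 6" "x + 6 + 11 = x + 17"
    by (simp_all add: x_def)
  have IH: "spiral_path (x + 11) - (\<Sum>j<i. chain_edge (6 * j) (6 * j + 6)) - chain_edge x (x + 11) \<in> spiral_relations k"
    using Suc by (simp add: x_def)
  have skips: "spiral_path (x + 13) - spiral_path (x + 11) - chain_edge (x + 11) (x + 13) \<in> spiral_relations k"
    "spiral_path (x + 15) - spiral_path (x + 13) - chain_edge (x + 13) (x + 15) \<in> spiral_relations k"
    "spiral_path (x + 17) - spiral_path (x + 15) - chain_edge (x + 15) (x + 17) \<in> spiral_relations k"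
    using x by (auto intro!: spiral_path_skip)
  have fan: "triangle_boundary x (x + 11) (x + 13) \<in> spiral_relations k"
    "triangle_boundary x (x + 13) (x + 15) \<in> spiral_relations k"
    "triangle_boundary x (x + 15) (x + 17) \<in> spiral_relations k"
    "triangle_boundary x (x + 6) (x + 17) \<in> spiral_relations k"
    using x by (auto intro!: spiral_relations_triangle simp: spiral_triangle_def)
  have "(spiral_path (x + 11) - (\<Sum>j<i. chain_edge (6 * j) (6 * j + 6)) - chain_edge x (x + 11))
      + (spiral_path (x + 13) - spiral_path (x + 11) - chain_edge (x + 11) (x + 13))
      + (spiral_path (x + 15) - spiral_path (x + 13) - chain_edge (x + 13) (x + 15))
      + (spiral_path (x + 17) - spiral_path (x + 15) - chain_edge (x + 15) (x + 17))
      + triangle_boundary x (x + 11) (x + 13) + triangle_boundary x (x + 13) (x + 15)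
      + triangle_boundary x (x + 15) (x + 17) - triangle_boundary x (x + 6) (x + 17) \<in> spiral_relations k"
    (is "?y \<in> _")
    using IH skips fan by (simp only: spiral_relations_add spiral_relations_diff)
  also have "?y = spiral_path (x + 17) - (\<Sum>j<i. chain_edge (6 * j) (6 * j + 6)) - chain_edge x (x + 6)
      - chain_edge (x + 6) (x + 17)"
    unfolding triangle_boundary_def by (simp only: algebra_simps)
  finally show ?case
    unfolding eqs sum.lessThan_Suc x(2) by (simp only: diff_diff_eq)
qed

text \<open>Seen from the cylinder, the zigzag is the helix, and every three helix steps make one
  straight edge plus one loop.\<close>

lemma spiral_path_triples:
  "6 * i \<le> 6 * k + 12 \<Longrightarrow> spiral_path (6 * i) - (\<Sum>j<i. chain_edge (6 * j) (6 * j + 6) + spiral_loop (6 * j))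
     \<in> spiral_relations k"
proof (induction i)
  case 0
  then show ?case
    by (simp add: spiral_path_def spiral_relations_0)
next
  case (Suc i)
  define x where "x = 6 * i"
  have x: "6 * Suc i = x + 6" "6 * i = x" "x + 6 \<le> 6 * k + 12"
    using Suc.prems by (simp_all add: x_def)
  have IH: "spiral_path x - (\<Sum>j<i. chain_edge (6 * j) (6 * j + 6) + spiral_loop (6 * j)) \<in> spiral_relations k"
    using Suc by (simp add: x_def)
  have skips: "spiral_path (x + 2) - spiral_path x - chain_edge x (x + 2) \<in> spiral_relations k"
    "spiral_path (x + 4) - spiral_path (x + 2) - chain_edge (x + 2) (x + 4) \<in> spiral_relations k"
    "spiral_path (x + 6) - spiral_path (x + 4) - chain_edge (x + 4) (x + 6) \<in> spiral_relations k"
    using x by (auto intro!: spiral_path_skip)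
  have "(spiral_path x - (\<Sum>j<i. chain_edge (6 * j) (6 * j + 6) + spiral_loop (6 * j)))
      + (spiral_path (x + 2) - spiral_path x - chain_edge x (x + 2))
      + (spiral_path (x + 4) - spiral_path (x + 2) - chain_edge (x + 2) (x + 4))
      + (spiral_path (x + 6) - spiral_path (x + 4) - chain_edge (x + 4) (x + 6)) \<in> spiral_relations k"
    (is "?y \<in> _")
    using IH skips by (intro spiral_relations_add)
  also have "?y = spiral_path (x + 6) - ((\<Sum>j<i. chain_edge (6 * j) (6 * j + 6) + spiral_loop (6 * j))
      + (chain_edge x (x + 6) + spiral_loop x))"
    unfolding spiral_loop_def by (simp only: algebra_simps)
  finally show ?case
    unfolding x(1,2) sum.lessThan_Suc .
qed

lemma frag_cmul_of_nat: "frag_cmul (int n) x = (\<Sum>j<n. x)"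
  by (induction n) (simp_all add: frag_cmul_distrib algebra_simps)

text \<open>The zigzag to the far end is evaluated twice, across the disc and along the helix. The
  straight lines cancel, which leaves \<open>k + 2\<close> loops against the boundary of the missing
  triangle.\<close>

lemma last_triangle_relation:
  "frag_cmul (int (k + 2)) (spiral_loop (6 * k + 6))
     - triangle_boundary (6 * k + 6) (6 * k + 11) (6 * k + 12) \<in> spiral_relations k"
proof -
  define x where "x = 6 * k"
  have x: "6 * k = x" "6 dvd x" "6 * Suc k = x + 6" "6 * (k + 2) = x + 12"
    by (simp_all add: x_def)
  let ?S = "\<Sum>j<k. chain_edge (6 * j) (6 * j + 6)"
  have strip: "spiral_path (x + 11) - ?S - chain_edge x (x + 11) \<in> spiral_relations k"
    using spiral_path_strip[of k k] by (simp add: x_def)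
  have tri: "triangle_boundary x (x + 6) (x + 11) \<in> spiral_relations k"
    using x by (intro spiral_relations_triangle) (auto simp: spiral_triangle_def)
  have path: "spiral_path (x + 12) = spiral_path (x + 11) + chain_edge (x + 11) (x + 12)"
    by (intro spiral_path_1) simp
  have sums: "(\<Sum>j<k + 2. chain_edge (6 * j) (6 * j + 6)) = ?S + chain_edge x (x + 6) + chain_edge (x + 6) (x + 12)"
    by (simp add: x_def add.commute)
  have "spiral_path (x + 12) - (\<Sum>j<k + 2. chain_edge (6 * j) (6 * j + 6) + spiral_loop (6 * j)) \<in> spiral_relations k"
    using spiral_path_triples[of "k + 2" k] by (simp only: x(4)) (simp add: x_def)
  then have triples: "spiral_path (x + 12) - (?S + chain_edge x (x + 6) + chain_edge (x + 6) (x + 12))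
      - (\<Sum>j<k + 2. spiral_loop (6 * j)) \<in> spiral_relations k"
    unfolding sum.distrib sums by (simp only: diff_diff_eq)
  \<comment> \<open>Each loop is moved to the far end by \<open>3 * (k + 1 - j)\<close> shifts of
    one helix step; the loop there avoids every pivot.\<close>
  have "spiral_loop (6 * j) - spiral_loop (x + 6) \<in> spiral_relations k" if "j < k + 2" for j
  proof -
    have "spiral_loop (6 * j) - spiral_loop (6 * j + 2 * (3 * (k + 1 - j))) \<in> spiral_relations k"
      using that by (intro spiral_loop_shifts) auto
    moreover have "6 * j + 2 * (3 * (k + 1 - j)) = x + 6"
      using that by (simp add: x_def)
    ultimately show ?thesis
      by simp
  qed
  then have "(\<Sum>j<k + 2. spiral_loop (6 * j) - spiral_loop (x + 6)) \<in> spiral_relations k"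
    by (intro spiral_relations_sum) simp
  then have loops: "(\<Sum>j<k + 2. spiral_loop (6 * j)) - frag_cmul (int (k + 2)) (spiral_loop (x + 6)) \<in> spiral_relations k"
    unfolding sum_subtractf frag_cmul_of_nat .
  have "(spiral_path (x + 11) - ?S - chain_edge x (x + 11)) - triangle_boundary x (x + 6) (x + 11)
      - (spiral_path (x + 12) - (?S + chain_edge x (x + 6) + chain_edge (x + 6) (x + 12))
      - (\<Sum>j<k + 2. spiral_loop (6 * j)))
      - ((\<Sum>j<k + 2. spiral_loop (6 * j)) - frag_cmul (int (k + 2)) (spiral_loop (x + 6))) \<in> spiral_relations k"
    (is "?y \<in> _")
    using strip tri triples loops by (simp only: spiral_relations_add spiral_relations_diff)
  also have "?y = frag_cmul (int (k + 2)) (spiral_loop (x + 6)) - triangle_boundary (x + 6) (x + 11) (x + 12)"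
    unfolding triangle_boundary_def path by (simp only: algebra_simps)
  finally show ?thesis
    unfolding x(1) .
qed

section \<open>The collapse applied to the complex\<close>

definition set_triangle :: "(nat \<Rightarrow> nat \<Rightarrow> nat \<Rightarrow> 'b) \<Rightarrow> nat set \<Rightarrow> 'b" where
  "set_triangle f t = (let xs = sorted_list_of_set t in f (xs ! 0) (xs ! 1) (xs ! 2))"

lemma set_triangle_eq:
  "a < b \<Longrightarrow> b < c \<Longrightarrow> set_triangle f {a, b, c} = f a b c"
  by (simp only: set_triangle_def sorted_list_of_set_3 Let_def) (simp add: numeral_2_eq_2)

lemma lookup_triangle_boundary_neq_0:
  assumes "Poly_Mapping.lookup (triangle_boundary a b c) e \<noteq> 0"
  shows "e = {a, b} \<or> e = {a, c} \<or> e = {b, c}"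
  using assms by (auto simp: triangle_boundary_def chain_edge_def lookup_add lookup_minus split: if_splits)

lemma lookup_triangle_boundary_unit:
  assumes "a < b" "b < c" "e = {a, b} \<or> e = {a, c} \<or> e = {b, c}"
  shows "\<bar>Poly_Mapping.lookup (triangle_boundary a b c) e\<bar> = 1"
proof -
  have "{a, b} \<noteq> {a, c}" "{a, b} \<noteq> {b, c}" "{a, c} \<noteq> {b, c}"
    using assms(1,2) by (auto simp: doubleton_eq_iff)
  then show ?thesis
    using assms(3) by (auto simp: triangle_boundary_def chain_edge_def lookup_add lookup_minus)
qed

lemma spiral_pivot_in:
  assumes "spiral_pivot a b c = (u, w)"
  shows "u = a \<and> w = b \<or> u = a \<and> w = c \<or> u = b \<and> w = c"
  using assms by (auto simp: spiral_pivot_def split: if_splits)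

text \<open>So the last loop survives the collapse. Its helix edges are never pivots, and its
  closing edge would be one only for a cylinder triangle reaching beyond the far end.\<close>

lemma spiral_pivot_not_in_loop:
  assumes t: "spiral_triangle (k + 2) a b c" "(a, b, c) \<noteq> (6 * k + 6, 6 * k + 11, 6 * k + 12)"
    and p: "spiral_pivot a b c = (u, w)"
  shows "w \<noteq> u + 2 \<and> \<not> (u = 6 * k + 6 \<and> w = 6 * k + 12)"
proof -
  obtain r where r: "spiral_rank (k + 2) a b c = r"
    by blast
  have le: "c \<le> 6 * k + 12"
    using spiral_triangle_less[OF _ t(1)] by simp
  show ?thesis
    by (rule spiral_triangleE[OF t p r]; insert le; simp)
qed

lemma lookup_spiral_loop:
  assumes "u < w" "w \<noteq> u + 2" "\<not> (u = v \<and> w = v + 6)"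
  shows "Poly_Mapping.lookup (spiral_loop v) {u, w} = 0"
  using assms by (auto simp: spiral_loop_def chain_edge_def lookup_add lookup_minus doubleton_eq_iff)

lemma spiral_loop_in_cycles:
  assumes "even v" "v + 6 \<le> 6 * m"
  shows "spiral_loop v \<in> simplicial_cycles 1 (spiral_complex m)"
proof -
  have "spiral_adj m v (v + 2)" "spiral_adj m (v + 2) (v + 4)" "spiral_adj m (v + 4) (v + 6)"
    "spiral_adj m v (v + 6)"
    using assms by (auto simp: spiral_adj_def)
  then have "Poly_Mapping.keys (spiral_loop v) \<subseteq> spiral_edges m"
    unfolding spiral_loop_def chain_edge_def
    by (intro keys_subset_intros) (auto simp: spiral_edges_def)
  moreover have "simplicial_boundary 1 (chain_edge a b) = frag_of {b} - frag_of {a}" if "a < b" for a b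
    unfolding chain_edge_def using that by (rule simplicial_boundary_edge)
  then have "simplicial_boundary 1 (spiral_loop v) = 0"
    unfolding spiral_loop_def simplicial_boundary_diff simplicial_boundary_add by simp
  ultimately show ?thesis
    by (simp only: mem_simplicial_cycles simplices_1_spiral_complex)
qed

lemma torsion_spiral_complex:
  "torsion_subgroup (simplicial_homology 1 (spiral_complex (k + 2))) \<cong> integer_mod_group (k + 2)"
proof -
  let ?X = "spiral_complex (k + 2)" and ?t0 = "last_triangle k" and ?g = "spiral_loop (6 * k + 6)"
  have triangles: "simplices 2 ?X = {{a, b, c} |a b c. spiral_triangle (k + 2) a b c}"
    by (rule simplices_2_spiral_complex) simp
  have "spiral_triangle (k + 2) (6 * k + 6) (6 * k + 11) (6 * k + 12)"
    by (simp add: spiral_triangle_def)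
  then have t0: "?t0 \<in> simplices 2 ?X"
    unfolding triangles last_triangle_def by blast
  have triangleE: "\<exists>a b c. t = {a, b, c} \<and> a < b \<and> b < c \<and> spiral_triangle (k + 2) a b c \<and>
      (a, b, c) \<noteq> (6 * k + 6, 6 * k + 11, 6 * k + 12) \<and> c \<le> 6 * k + 12"
    if "t \<in> simplices 2 ?X - {?t0}" for t
  proof -
    from that obtain a b c where t: "t = {a, b, c}" "spiral_triangle (k + 2) a b c"
      unfolding triangles by blast
    have "a < b" "b < c" "c \<le> 6 * k + 12"
      using spiral_triangle_less[OF _ t(2)] by simp_all
    moreover have "(a, b, c) \<noteq> (6 * k + 6, 6 * k + 11, 6 * k + 12)"
      using that t(1) by (auto simp: last_triangle_def)
    ultimately show ?thesis
      using t by blast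
  qed
  have boundary: "simplicial_boundary 2 (frag_of {a, b, c}) = triangle_boundary a b c"
    if "a < b" "b < c" for a b c :: nat
    using that by (simp add: simplicial_boundary_triangle triangle_boundary_def chain_edge_def)
  define p where "p = set_triangle (\<lambda>a b c. case spiral_pivot a b c of (u, w) \<Rightarrow> {u, w})"
  define r where "r = set_triangle (spiral_rank (k + 2))"
  \<comment> \<open>This chain completes the last triangle to one that bounds \<open>k + 2\<close>
    times the loop.\<close>
  obtain c where c: "Poly_Mapping.keys c \<subseteq> simplices 2 ?X - {?t0}"
    "simplicial_boundary 2 c = frag_cmul (int (k + 2)) ?g
      - triangle_boundary (6 * k + 6) (6 * k + 11) (6 * k + 12)"
    using last_triangle_relation[of k] unfolding spiral_relations_def by (elim imageE CollectE) metis
  show ?thesis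
  \<comment> \<open>The edge \<open>e\<close> is the closing edge of the loop, where the coefficient
    is -1.\<close>
  proof (rule torsion_simplicial_homology_1[where p = p and r = r and e = "{6 * k + 6, 6 * k + 12}"])
    show "simplicial_complex ?X"
      by (intro simplicial_complex_if_flag_complex flag_complex_spiral_complex)
    show "?g \<in> simplicial_cycles 1 ?X"
      by (rule spiral_loop_in_cycles) simp_all
    show "simplicial_boundary 2 (frag_of ?t0 + c) = frag_cmul (int (k + 2)) ?g"
      unfolding simplicial_boundary_add c(2) last_triangle_def by (subst boundary) simp_all
    show "\<bar>Poly_Mapping.lookup ?g {6 * k + 6, 6 * k + 12}\<bar> = 1"
      by (simp add: spiral_loop_def chain_edge_def lookup_add lookup_minus doubleton_eq_iff)
  next
    fix t assume "t \<in> simplices 2 ?X - {?t0}"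
    from triangleE[OF this] obtain a b c where t: "t = {a, b, c}" "a < b" "b < c"
      "spiral_triangle (k + 2) a b c" "(a, b, c) \<noteq> (6 * k + 6, 6 * k + 11, 6 * k + 12)" "c \<le> 6 * k + 12"
      by blast
    obtain u w where uw: "spiral_pivot a b c = (u, w)"
      by fastforce
    then have pt: "p t = {u, w}"
      unfolding p_def t(1) set_triangle_eq[OF t(2,3)] by simp
    have less: "u < w"
      using spiral_pivot_in[OF uw] t(2,3) by auto
    show "\<bar>Poly_Mapping.lookup (simplicial_boundary 2 (frag_of t)) (p t)\<bar> = 1"
      unfolding pt unfolding t(1) boundary[OF t(2,3)]
      using spiral_pivot_in[OF uw] by (intro lookup_triangle_boundary_unit t(2,3)) auto
    show "Poly_Mapping.lookup ?g (p t) = 0"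
      unfolding pt using spiral_pivot_not_in_loop[OF t(4,5) uw] less by (intro lookup_spiral_loop) auto
    fix t' assume "t' \<in> simplices 2 ?X - {?t0}"
    from triangleE[OF this] obtain a' b' c' where t': "t' = {a', b', c'}" "a' < b'" "b' < c'"
      "spiral_triangle (k + 2) a' b' c'" "(a', b', c') \<noteq> (6 * k + 6, 6 * k + 11, 6 * k + 12)" "c' \<le> 6 * k + 12"
      by blast
    assume "t' \<noteq> t"
    then have ne: "(a', b', c') \<noteq> (a, b, c)"
      using t(1) t'(1) by auto
    assume "Poly_Mapping.lookup (simplicial_boundary 2 (frag_of t')) (p t) \<noteq> 0"
    then have "{u, w} = {a', b'} \<or> {u, w} = {a', c'} \<or> {u, w} = {b', c'}"
      unfolding pt unfolding t'(1) boundary[OF t'(2,3)] by (rule lookup_triangle_boundary_neq_0)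
    then have "u = a' \<and> w = b' \<or> u = a' \<and> w = c' \<or> u = b' \<and> w = c'"
      using less t'(2,3) by (auto simp: doubleton_eq_iff)
    from spiral_rank_less[OF t(4,5) t'(4,5) ne uw this t(6) t'(6)]
    show "r t' < r t"
      unfolding r_def t(1) t'(1) set_triangle_eq[OF t(2,3)] set_triangle_eq[OF t'(2,3)] .
  qed (use t0 c(1) in simp_all)
qed

theorem theorem3p1:
  fixes m :: nat
  assumes "m \<ge> 2"
  shows "\<exists>X :: nat set set.
           flag_complex X \<and> has_dimension X 2 \<and>
           torsion_subgroup (simplicial_homology 1 X) \<cong> integer_mod_group m \<and>
           maxdeg X \<le> 12"
proof (intro exI conjI)
  show "torsion_subgroup (simplicial_homology 1 (spiral_complex m)) \<cong> integer_mod_group m"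
    using torsion_spiral_complex[of "m - 2"] assms by (simp only: le_add_diff_inverse2)
qed (simp_all add: assms flag_complex_spiral_complex has_dimension_spiral_complex maxdeg_spiral_complex)

end
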